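(* Let $\Omega=\{x\in\mathbb{R}^n:g(x)\le0\}$, where $g=(g_1,\ldots,g_m)\colon\mathbb{R}^n\to\mathbb{R}^m$ has convex differentiable components and satisfies the Slater condition. Fix $\bar x\in\Omega$ with $J(\bar x):=\{j:g_j(\bar x)=0\}\ne\emptyset$, take $B_K=\{u^j\}_{j\in J(\bar x)}$ to be the normalized conic base of $K=\operatorname{cone}\{\nabla g_j(\bar x):j\in J(\bar x)\}$, and set $d:=-P_{\operatorname{aff}(B_K)}(0)$. Then for every $w\in\mathbb{R}^n\setminus\{0\}$ the quantity $$\sigma^\star(w):=\begin{cases}+\infty, & \max_{j\in J(\bar x)}\langle w,u^j\rangle\le0,\\[1mm]\dfrac{\|d\|^2}{\max_{j\in J(\bar x)}\langle w,u^j\rangle}, & \text{otherwise,}\end{cases}$$ is the supremum of the $\sigma\ge0$ for which $d+\sigma w$ is an interior feasible direction for $\Omega$ at $\bar x$.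
   Context: $\langle\cdot,\cdot\rangle$ and $\|\cdot\|$ are the Euclidean inner product and norm; $g(x)\le0$ is componentwise. Slater condition: there is $\hat x\in\mathbb{R}^n$ with $g_j(\hat x)<0$ for all $j$. The normalized conic base $B_K$ of the finitely generated cone $K$ is the set of unit vectors along its extreme rays, here indexed by the active constraints $j\in J(\bar x)$ ($u^j$ being the normalization of $\nabla g_j(\bar x)$). $\operatorname{aff}(B_K)$ is the affine hull and $P_{\operatorname{aff}(B_K)}(0)$ is the orthogonal projection of the origin onto it (this is the circumcenter of $B_K$). The tangent cone is $T_\Omega(\bar x)=\{v\in\mathbb{R}^n:\exists\, v_k\to v,\ t_k\downarrow0,\ \bar x+t_kv_k\in\Omega\}$. An interior feasible direction for $\Omega$ at $\bar x$ is an element of the interior of $T_\Omega(\bar x)$; under Slater's condition $T_\Omega(\bar x)=K^\circ=\{w:\langle w,z\rangle\le0\ \text{for all }z\in K\}$.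
   Formalization: The formal theorem additionally assumes that d ≠ 0 or max_j ⟨w,u^j⟩ ≠ 0; when both vanish, no σ ≥ 0 makes d+σw an interior feasible direction, while σ*(w) = +∞, so the claim fails there. The supremum is taken in [0,+∞]. *)

theory Defs
  imports "HOL-Analysis.Analysis"
begin

text \<open>The gradient is meaningful only where the function is differentiable.\<close>

definition gradient :: "('a::real_inner \<Rightarrow> real) \<Rightarrow> 'a \<Rightarrow> 'a"
  where "gradient f x = (THE D. GDERIV f x :> D)"

definition slater_condition :: "(real^'n \<Rightarrow> real^'m) \<Rightarrow> bool"
  where "slater_condition g \<longleftrightarrow> (\<exists>x. \<forall>j. g x $ j < 0)"

text \<open>The sequences witnessing \<open>t\<^sub>k \<down> 0\<close> are positive and tend to 0, not necessarily monotone;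
  passing to subsequences, monotonicity would give the same set.\<close>

definition tangent_cone :: "'a::real_normed_vector set \<Rightarrow> 'a \<Rightarrow> 'a set"
  where "tangent_cone \<Omega> x =
    {v. \<exists>(V :: nat \<Rightarrow> 'a) (t :: nat \<Rightarrow> real).
          V \<longlonglongrightarrow> v \<and> (\<forall>k. t k > 0) \<and> t \<longlonglongrightarrow> 0 \<and> (\<forall>k. x + t k *\<^sub>R V k \<in> \<Omega>)}"

definition interior_feasible_direction :: "'a::real_normed_vector set \<Rightarrow> 'a \<Rightarrow> 'a \<Rightarrow> bool"
  where "interior_feasible_direction \<Omega> x v \<longleftrightarrow> v \<in> interior (tangent_cone \<Omega> x)"

text \<open>An extreme ray is a half-line from the origin that is a face of the cone; for a unit
  vector \<open>u\<close>, \<open>conic hull {u}\<close> is the half-line it spans.\<close>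

definition normalized_conic_base :: "'a::real_inner set \<Rightarrow> 'a set"
  where "normalized_conic_base K = {u. norm u = 1 \<and> (conic hull {u}) face_of K}"

definition sigma_star :: "'a::real_inner \<Rightarrow> ('m \<Rightarrow> 'a) \<Rightarrow> 'm set \<Rightarrow> 'a \<Rightarrow> ennreal"
  where "sigma_star d u J w =
    (if (MAX j\<in>J. w \<bullet> u j) \<le> 0 then \<infinity>
     else ennreal ((norm d)\<^sup>2 / (MAX j\<in>J. w \<bullet> u j)))"

end

theory Submission
  imports Defs
begin

text \<open>The projection of the origin onto an affine set has the same inner product with every point of
  that set, so \<open>d \<bullet> u j = - \<parallel>d\<parallel>\<^sup>2\<close> for all active \<open>j\<close>. Slater's condition makes the active gradients
  nonzero and the interior of the tangent cone is cut out by the strict inequalities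
  \<open>v \<bullet> u j < 0\<close>. Hence \<open>d + \<sigma> w\<close> is interior feasible iff \<open>\<sigma> max\<^sub>j (w \<bullet> u j) < \<parallel>d\<parallel>\<^sup>2\<close>.\<close>

lemma inner_closest_point_affine:
  fixes S :: "'a::euclidean_space set"
  assumes "affine S" "b \<in> S"
  shows "closest_point S 0 \<bullet> b = (norm (closest_point S 0))\<^sup>2"
proof -
  define p where "p = closest_point S 0"
  have cl: "closed S" "convex S"
    using assms(1) closed_affine_hull[of S] by (auto simp: hull_same affine_imp_convex)
  have p: "p \<in> S"
    unfolding p_def using cl assms(2) by (intro closest_point_in_set) auto
  have le: "p \<bullet> p \<le> p \<bullet> x" if "x \<in> S" for x
    using closest_point_dot[OF cl(2,1) that, of 0] by (simp add: p_def inner_simps)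
  \<comment> \<open>This point is the reflection of \<open>b\<close> through the projection and
    stays in the affine set. Applying \<open>le\<close> to it and to \<open>b\<close> yields
    opposite inequalities.\<close>
  have "2 *\<^sub>R p + (-1) *\<^sub>R b \<in> S"
    using assms p by (intro mem_affine) auto
  from le[OF this] le[OF assms(2)] show ?thesis
    by (simp add: p_def inner_simps power2_norm_eq_inner)
qed

lemma GDERIV_gradient:
  fixes f :: "'a::euclidean_space \<Rightarrow> real"
  assumes "f differentiable (at x)"
  shows "GDERIV f x :> gradient f x"
proof -
  obtain f' where f': "(f has_derivative f') (at x)"
    using assms by (auto simp: differentiable_def)
  then interpret bounded_linear f'
    by (rule has_derivative_bounded_linear)
  \<comment> \<open>Riesz representation: in finite dimension the functional \<open>f'\<close> is
    the inner product with the image of 1 under its adjoint.\<close>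
  have "f' = (\<lambda>h. h \<bullet> adjoint f' 1)"
    using adjoint_works[OF linear_axioms, of _ 1] by (auto simp: inner_commute)
  with f' have D: "GDERIV f x :> adjoint f' 1"
    by (simp add: gderiv_def)
  have uniq: "E = adjoint f' 1" if "GDERIV f x :> E" for E
  proof -
    have "(\<lambda>h. h \<bullet> E) = (\<lambda>h. h \<bullet> adjoint f' 1)"
      using that D unfolding gderiv_def by (rule has_derivative_unique)
    then show ?thesis
      by (metis vector_eq_ldot)
  qed
  from D uniq show ?thesis
    unfolding gradient_def by (rule theI)
qed

lemma GDERIV_along_line:
  assumes "GDERIV f x :> D"
  shows "((\<lambda>s. f (x + s *\<^sub>R h)) has_real_derivative h \<bullet> D) (at 0)"
proof -
  have "((\<lambda>s. x + s *\<^sub>R h) has_derivative (\<lambda>s. s *\<^sub>R h)) (at 0)"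
    by (auto intro!: derivative_eq_intros)
  moreover have "(f has_derivative (\<lambda>h. h \<bullet> D)) (at (x + 0 *\<^sub>R h))"
    using assms by (simp add: gderiv_def)
  ultimately have "((\<lambda>s. f (x + s *\<^sub>R h)) has_derivative (\<lambda>s. (s *\<^sub>R h) \<bullet> D)) (at 0)"
    by (rule has_derivative_compose)
  then show ?thesis
    by (simp add: has_field_derivative_def mult_commute_abs)
qed

text \<open>Restricting \<open>f\<close> to the line through \<open>x\<close> with direction
  \<open>h\<close> reduces the claim to one real variable: the tangent at 0 lies below the
  restriction at 1.\<close>

lemma convex_on_above_tangent_GDERIV:
  assumes "convex_on UNIV f" "GDERIV f x :> D"
  shows "f x + h \<bullet> D \<le> f (x + h)"
proof -
  have "convex_on UNIV (\<lambda>s. f (x + s *\<^sub>R h))"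
  proof (rule convex_onI)
    fix t a b :: real
    assume "0 < t" "t < 1"
    have "x + ((1 - t) *\<^sub>R a + t *\<^sub>R b) *\<^sub>R h
        = (1 - t) *\<^sub>R (x + a *\<^sub>R h) + t *\<^sub>R (x + b *\<^sub>R h)"
      by (simp add: algebra_simps)
    with convex_onD[OF assms(1), of t "x + a *\<^sub>R h" "x + b *\<^sub>R h"] \<open>0 < t\<close> \<open>t < 1\<close>
    show "f (x + ((1 - t) *\<^sub>R a + t *\<^sub>R b) *\<^sub>R h)
        \<le> (1 - t) * f (x + a *\<^sub>R h) + t * f (x + b *\<^sub>R h)"
      by simp
  qed simp
  from convex_on_imp_above_tangent[OF this, of 0 1 "h \<bullet> D"] GDERIV_along_line[OF assms(2), of h]
  show ?thesis by simp
qed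

lemma tangent_coneI:
  assumes "\<forall>\<^sub>F s in at_right 0. x + s *\<^sub>R v \<in> \<Omega>"
  shows "v \<in> tangent_cone \<Omega> x"
proof -
  obtain e :: real where e: "e > 0" "\<And>s. 0 < s \<Longrightarrow> s < e \<Longrightarrow> x + s *\<^sub>R v \<in> \<Omega>"
    using assms unfolding eventually_at_right_field by auto
  \<comment> \<open>A constant sequence of directions will do, so only step sizes are chosen; the
    factor 1/2 keeps even \<open>t 0\<close> strictly below \<open>e\<close>.\<close>
  define t where "t k = e / 2 * inverse (real (Suc k))" for k
  have t: "0 < t k" "t k < e" for k
  proof -
    show "0 < t k" using e(1) by (simp add: t_def)
    have "e / 2 * inverse (real (Suc k)) \<le> e / 2 * 1"
      using e(1) by (intro mult_left_mono) (auto simp: inverse_le_1_iff)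
    then show "t k < e" using e(1) unfolding t_def by linarith
  qed
  have "t \<longlonglongrightarrow> e / 2 * 0"
    unfolding t_def by (intro tendsto_intros LIMSEQ_inverse_real_of_nat)
  then have "t \<longlonglongrightarrow> 0" by simp
  moreover have "x + t k *\<^sub>R v \<in> \<Omega>" for k
    using t e(2) by blast
  ultimately show ?thesis
    unfolding tangent_cone_def using t(1) by (intro CollectI exI[of _ "\<lambda>_. v"] exI[of _ t]) auto
qed

text \<open>Each active constraint confines the tangent cone to a closed halfspace, whose interior
  is the open halfspace because its normal is nonzero. Conversely, the open halfspaces of the active
  constraints intersect in an open set of tangent directions.\<close>

lemma interior_feasible_direction_convex_inequalities:
  fixes g :: "'a::euclidean_space \<Rightarrow> real^'m"
  assumes convex: "\<And>j. convex_on UNIV (\<lambda>x. g x $ j)"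
    and D: "\<And>j. GDERIV (\<lambda>x. g x $ j) x :> D j"
    and x: "\<And>j. g x $ j \<le> 0"
    and nz: "\<And>j. g x $ j = 0 \<Longrightarrow> D j \<noteq> 0"
  shows "interior_feasible_direction {x. \<forall>j. g x $ j \<le> 0} x v
    \<longleftrightarrow> (\<forall>j. g x $ j = 0 \<longrightarrow> v \<bullet> D j < 0)"
    (is "interior_feasible_direction ?\<Omega> x v \<longleftrightarrow> ?R v")
proof
  assume "interior_feasible_direction ?\<Omega> x v"
  then have int: "v \<in> interior (tangent_cone ?\<Omega> x)"
    by (simp add: interior_feasible_direction_def)
  show "?R v"
  proof (intro allI impI)
    fix j assume j: "g x $ j = 0"
    have "tangent_cone ?\<Omega> x \<subseteq> {v. D j \<bullet> v \<le> 0}"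
    proof
      fix v assume "v \<in> tangent_cone ?\<Omega> x"
      then obtain V t where V: "V \<longlonglongrightarrow> v" and t: "\<And>k. t k > 0"
        and m: "\<And>k. x + t k *\<^sub>R V k \<in> ?\<Omega>"
        unfolding tangent_cone_def by blast
      have "D j \<bullet> V k \<le> 0" for k
      proof -
        \<comment> \<open>The tangent inequality and feasibility squeeze:
          \<open>t k * (V k \<bullet> D j)\<close> is at most the value of the active constraint at
          \<open>x + t k *\<^sub>R V k\<close>, which is at most 0.\<close>
        have "t k * (V k \<bullet> D j) \<le> 0"
          using convex_on_above_tangent_GDERIV[OF convex D, of j "t k *\<^sub>R V k"] m[of k] j
          by (force intro: order_trans)
        then show ?thesis
          using t[of k] by (simp add: mult_le_0_iff inner_commute)
      qed
      moreover have "(\<lambda>k. D j \<bullet> V k) \<longlonglongrightarrow> D j \<bullet> v"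
        by (intro tendsto_intros V)
      ultimately show "v \<in> {v. D j \<bullet> v \<le> 0}"
        by (auto intro: LIMSEQ_le_const2)
    qed
    then have "v \<in> interior {v. D j \<bullet> v \<le> 0}"
      using int interior_mono by blast
    then show "v \<bullet> D j < 0"
      using interior_halfspace_le[OF nz[OF j], of 0] by (simp add: inner_commute)
  qed
next
  assume R: "?R v"
  have "{v. ?R v} = (\<Inter>j\<in>{j. g x $ j = 0}. {v. D j \<bullet> v < 0})"
    by (auto simp: inner_commute)
  then have "open {v. ?R v}"
    by (simp add: open_INT open_halfspace_lt)
  moreover have "{v. ?R v} \<subseteq> tangent_cone ?\<Omega> x"
  proof
    fix v assume v: "v \<in> {v. ?R v}"
    \<comment> \<open>A short step preserves an active constraint because its slope along
      \<open>v\<close> is negative, and an inactive one by continuity.\<close>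
    have "\<forall>\<^sub>F s in at_right 0. g (x + s *\<^sub>R v) $ j \<le> 0" for j
    proof (cases "g x $ j = 0")
      case True
      have "v \<bullet> D j < 0" using v True by simp
      from DERIV_neg_dec_right[OF GDERIV_along_line[OF D] this] obtain e :: real where
        "e > 0" "\<forall>s>0. s < e \<longrightarrow> g (x + s *\<^sub>R v) $ j < 0"
        using True by auto
      then show ?thesis
        unfolding eventually_at_right_field by (auto intro!: exI[of _ e] less_imp_le)
    next
      case False
      then have "g x $ j < 0" using x[of j] by simp
      moreover have "isCont (\<lambda>s. g (x + s *\<^sub>R v) $ j) 0"
        using GDERIV_along_line[OF D] by (rule DERIV_isCont)
      then have "((\<lambda>s. g (x + s *\<^sub>R v) $ j) \<longlongrightarrow> g x $ j) (at_right 0)"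
        by (auto simp: isCont_def intro: filterlim_mono at_le)
      ultimately have "\<forall>\<^sub>F s in at_right 0. g (x + s *\<^sub>R v) $ j < 0"
        using order_tendstoD(2) by blast
      then show ?thesis by (rule eventually_mono) simp
    qed
    then have "\<forall>\<^sub>F s in at_right 0. x + s *\<^sub>R v \<in> ?\<Omega>"
      by (simp add: eventually_all_finite)
    then show "v \<in> tangent_cone ?\<Omega> x"
      by (rule tangent_coneI)
  qed
  ultimately show "interior_feasible_direction ?\<Omega> x v"
    unfolding interior_feasible_direction_def using R interiorI by blast
qed

text \<open>If \<open>c\<close> and \<open>M\<close> both vanished, no \<sigma> would qualify and
  the supremum would be 0 rather than infinity; the second assumption excludes this. If
  \<open>c = 0\<close> and \<open>M > 0\<close>, the set is also empty, but the supremum 0 of the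
  empty set in \<open>ennreal\<close> agrees with \<open>c / M\<close>.\<close>

lemma SUP_ennreal_mult_less:
  fixes M c :: real
  assumes "0 \<le> c" "c \<noteq> 0 \<or> M \<noteq> 0"
  shows "(SUP \<sigma>\<in>{\<sigma>. 0 \<le> \<sigma> \<and> \<sigma> * M < c}. ennreal \<sigma>) = (if M \<le> 0 then \<infinity> else ennreal (c / M))"
proof (cases "M \<le> 0")
  case True
  have "\<exists>\<sigma>\<in>{\<sigma>. 0 \<le> \<sigma> \<and> \<sigma> * M < c}. y < ennreal \<sigma>" if y: "y < top" for y
  proof -
    obtain r where r: "0 \<le> r" "y = ennreal r"
      using y by (cases y) auto
    \<comment> \<open>The witness \<open>r + 1\<close> exceeds \<open>r\<close> and is positive, so
      the product is strictly negative when \<open>M < 0\<close>, even if \<open>c = 0\<close>. When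
      \<open>M = 0\<close>, strictness comes from \<open>c > 0\<close>.\<close>
    have "(r + 1) * M \<le> 0" "M < 0 \<Longrightarrow> (r + 1) * M < 0"
      using r True by (auto simp: mult_le_0_iff mult_less_0_iff)
    then have "(r + 1) * M < c"
      using assms True by (cases "M = 0") auto
    then show ?thesis
      using r by (intro bexI[of _ "r + 1"]) (auto simp: ennreal_less_iff)
  qed
  then show ?thesis
    using True by (simp only: SUP_eq_top_iff infinity_ennreal_def if_True) blast
next
  case False
  then have iff: "\<sigma> * M < c \<longleftrightarrow> \<sigma> < c / M" for \<sigma>
    by (simp add: pos_less_divide_eq)
  have "ennreal (c / M) \<le> (SUP \<sigma>\<in>{\<sigma>. 0 \<le> \<sigma> \<and> \<sigma> * M < c}. ennreal \<sigma>)"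
    unfolding le_SUP_iff
  proof (intro allI impI)
    fix y assume "y < ennreal (c / M)"
    then obtain r where r: "0 \<le> r" "y = ennreal r" "r < c / M"
      by (cases y) (auto simp: ennreal_less_iff)
    \<comment> \<open>The bound \<open>c / M\<close> itself is not admissible, so density supplies
      an admissible value above \<open>r\<close>.\<close>
    then obtain s where "r < s" "s < c / M"
      using dense by blast
    then show "\<exists>\<sigma>\<in>{\<sigma>. 0 \<le> \<sigma> \<and> \<sigma> * M < c}. y < ennreal \<sigma>"
      using r by (intro bexI[of _ s]) (auto simp: ennreal_less_iff iff)
  qed
  moreover have "(SUP \<sigma>\<in>{\<sigma>. 0 \<le> \<sigma> \<and> \<sigma> * M < c}. ennreal \<sigma>) \<le> ennreal (c / M)"
    by (intro SUP_least) (auto simp: iff intro!: ennreal_leI)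
  ultimately show ?thesis
    using False by (simp add: antisym)
qed

theorem proposition7p1:
  fixes g :: "real^'n \<Rightarrow> real^'m"
    and \<Omega> :: "(real^'n) set"
    and xbar d w :: "real^'n"
    and J :: "'m set"
    and u :: "'m \<Rightarrow> real^'n"
    and K B :: "(real^'n) set"
  assumes convex: "\<And>j. convex_on UNIV (\<lambda>x. g x $ j)"
    and differentiable: "\<And>j x. (\<lambda>x. g x $ j) differentiable (at x)"
    and slater: "slater_condition g"
    and \<Omega>: "\<Omega> = {x. \<forall>j. g x $ j \<le> 0}"
    and xbar: "xbar \<in> \<Omega>"
    and J: "J = {j. g xbar $ j = 0}"
    and J_nonempty: "J \<noteq> {}"
    and K: "K = convex_cone hull ((\<lambda>j. gradient (\<lambda>x. g x $ j) xbar) ` J)"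
    and u: "\<And>j. j \<in> J \<Longrightarrow> u j = sgn (gradient (\<lambda>x. g x $ j) xbar)"
    and B: "B = normalized_conic_base K" "B = u ` J"
    and d: "d = - closest_point (affine hull B) 0"
    and w: "w \<noteq> 0"
    and nondegenerate: "d \<noteq> 0 \<or> (MAX j\<in>J. w \<bullet> u j) \<noteq> 0"
  shows "(SUP \<sigma>\<in>{\<sigma>::real. \<sigma> \<ge> 0 \<and> interior_feasible_direction \<Omega> xbar (d + \<sigma> *\<^sub>R w)}. ennreal \<sigma>)
           = sigma_star d u J w"
proof -
  define D where "D j = gradient (\<lambda>x. g x $ j) xbar" for j
  define M where "M = (MAX j\<in>J. w \<bullet> u j)"
  have GD: "GDERIV (\<lambda>x. g x $ j) xbar :> D j" for j
    unfolding D_def by (rule GDERIV_gradient[OF differentiable])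
  \<comment> \<open>A vanishing gradient would make \<open>xbar\<close> a global minimizer of a
    convex constraint with minimum 0, contradicting the Slater point.\<close>
  have D_nz: "D j \<noteq> 0" if "g xbar $ j = 0" for j
  proof
    assume "D j = 0"
    obtain z where z: "g z $ j < 0"
      using slater by (auto simp: slater_condition_def)
    from convex_on_above_tangent_GDERIV[OF convex GD, of j "z - xbar"] \<open>D j = 0\<close> that z
    show False by simp
  qed
  \<comment> \<open>Normalizing a nonzero gradient scales it by a positive factor, which preserves
    signs of inner products.\<close>
  have u_neg: "v \<bullet> u j < 0 \<longleftrightarrow> v \<bullet> D j < 0" if "j \<in> J" for v j
    using u[OF that] D_nz[of j] that J
    by (simp add: D_def[symmetric] sgn_div_norm divide_less_0_iff mult_less_0_iff flip: divide_inverse_commute)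
  have ifd: "interior_feasible_direction \<Omega> xbar v \<longleftrightarrow> (\<forall>j\<in>J. v \<bullet> u j < 0)" for v
  proof -
    have "interior_feasible_direction \<Omega> xbar v \<longleftrightarrow> (\<forall>j. g xbar $ j = 0 \<longrightarrow> v \<bullet> D j < 0)"
      unfolding \<Omega> using xbar \<Omega> D_nz
      by (intro interior_feasible_direction_convex_inequalities convex GD) auto
    then show ?thesis using u_neg J by auto
  qed
  have d_u: "d \<bullet> u j = - (norm d)\<^sup>2" if "j \<in> J" for j
    unfolding d using inner_closest_point_affine[of "affine hull B" "u j"] that B(2)
    by (simp add: hull_inc)
  have "interior_feasible_direction \<Omega> xbar (d + \<sigma> *\<^sub>R w) \<longleftrightarrow> \<sigma> * M < (norm d)\<^sup>2"
    if "0 \<le> \<sigma>" for \<sigma>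
  proof -
    have "interior_feasible_direction \<Omega> xbar (d + \<sigma> *\<^sub>R w) \<longleftrightarrow> (\<forall>j\<in>J. \<sigma> * (w \<bullet> u j) < (norm d)\<^sup>2)"
      unfolding ifd using d_u by (auto simp: inner_simps)
    also have "\<dots> \<longleftrightarrow> \<sigma> * M < (norm d)\<^sup>2"
    \<comment> \<open>The maximum is attained since \<open>J\<close> is finite and nonempty, which
      gives one direction; the other multiplies the bound by \<open>M\<close> with \<sigma>, whose
      sign matters here.\<close>
    proof
      have "M \<in> (\<lambda>j. w \<bullet> u j) ` J"
        unfolding M_def using J_nonempty by (intro Max_in) auto
      then show "\<forall>j\<in>J. \<sigma> * (w \<bullet> u j) < (norm d)\<^sup>2 \<Longrightarrow> \<sigma> * M < (norm d)\<^sup>2"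
        by auto
      have "\<sigma> * (w \<bullet> u j) \<le> \<sigma> * M" if "j \<in> J" for j
        unfolding M_def using that \<open>0 \<le> \<sigma>\<close> by (intro mult_left_mono Max_ge) auto
      then show "\<sigma> * M < (norm d)\<^sup>2 \<Longrightarrow> \<forall>j\<in>J. \<sigma> * (w \<bullet> u j) < (norm d)\<^sup>2"
        using le_less_trans by blast
    qed
    finally show ?thesis .
  qed
  then have "{\<sigma>. \<sigma> \<ge> 0 \<and> interior_feasible_direction \<Omega> xbar (d + \<sigma> *\<^sub>R w)}
      = {\<sigma>. 0 \<le> \<sigma> \<and> \<sigma> * M < (norm d)\<^sup>2}"
    by auto
  then show ?thesis
    using nondegenerate SUP_ennreal_mult_less[of "(norm d)\<^sup>2" M]
    by (simp add: sigma_star_def M_def)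
qed

end
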